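(* Let $G$ be a distance-regular graph of diameter $d\geq 1$, and let $F_2=F_2(G)$ be its $2$-token graph, with adjacency and Laplacian matrices $A(F_2)$ and $L(F_2)$ whose spectral radii (largest eigenvalues) are $\rho_A(F_2)$ and $\rho_L(F_2)$, respectively. Let $\rho_A(F_2/\pi)$ and $\rho_L(F_2/\pi)$ be the largest eigenvalues of the $d\times d$ matrices $A(F_2/\pi)$ and $L(F_2/\pi)$ (defined from the intersection array of $G$ in the context). Then: (a) $\rho_A(F_2)=\rho_A(F_2/\pi)$. (b) $\rho_L(F_2)\ge \rho_L(F_2/\pi)$, with equality if $G$ is bipartite.
   Context: All graphs are finite, simple and $G$ is connected. For $G=(V,E)$, the $2$-token graph $F_2(G)$ has as vertices the $2$-subsets of $V$, and two $2$-subsets $A,B$ are adjacent if and only if their symmetric difference is a pair $\{a,b\}$ with $a\in A$, $b\in B$ and $\{a,b\}\in E$. The Laplacian matrix of a graph is the diagonal degree matrix minus the adjacency matrix. $G$ is distance-regular with degree $\delta=b_0$, diameter $d$ and intersection array $\{b_0,b_1,\ldots,b_{d-1};c_1,c_2,\ldots,c_d\}$: for any vertices $u,v$ at distance $i$, the number of neighbors of $v$ at distance $i-1$, $i$, $i+1$ from $u$ is $c_i$, $a_i$, $b_i$, respectively (with $c_0=b_d=0$, $a_i+b_i+c_i=\delta$). The matrices are the tridiagonal $d\times d$ matrices $$A(F_2/\pi)=2\begin{pmatrix} a_1 & b_1 & & & \\ c_2 & a_2 & b_2 & & \\ & c_3 & a_3 & \ddots & \\ & & \ddots & \ddots & b_{d-1}\\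 & & & c_d & a_d\end{pmatrix},$$ $$L(F_2/\pi)=2\begin{pmatrix} b_1 & -b_1 & & & \\ -c_2 & c_2+b_2 & -b_2 & & \\ & -c_3 & c_3+b_3 & \ddots & \\ & & \ddots & \ddots & -b_{d-1}\\ & & & -c_d & c_d\end{pmatrix};$$ that is, rows and columns are indexed by $i=1,\dots,d$; $A(F_2/\pi)$ has diagonal entries $2a_i$, entries $2b_i$ in position $(i,i+1)$ and $2c_i$ in position $(i,i-1)$, and zeros elsewhere; $L(F_2/\pi)$ has entries $-2b_i$ in position $(i,i+1)$, $-2c_i$ in position $(i,i-1)$, zeros in the other off-diagonal positions, and diagonal entries making all row sums zero. *)

theory Defs
  imports
    "Graph_Theory.Pair_Digraph"
    "Graph_Theory.Digraph_Component"
    "Jordan_Normal_Form.Spectral_Radius"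
begin

text \<open>Finite simple graphs are values of type \<^typ>\<open>'a pair_pre_digraph\<close> satisfying
  \<^locale>\<open>pair_graph\<close>: finite, loop-free, and with a symmetric arc set, so that an edge
  is a pair of opposite arcs.\<close>

text \<open>Length of a shortest walk; only meaningful if \<open>v\<close> is reachable from \<open>u\<close>.\<close>

definition graph_dist :: "'a pair_pre_digraph \<Rightarrow> 'a \<Rightarrow> 'a \<Rightarrow> nat" where
  "graph_dist G u v = (LEAST n. \<exists>p. pre_digraph.awalk (with_proj G) u p v \<and> length p = n)"

definition graph_diameter :: "'a pair_pre_digraph \<Rightarrow> nat" where
  "graph_diameter G = Max {graph_dist G u v | u v. u \<in> pverts G \<and> v \<in> pverts G}"

definition bipartite :: "'a pair_pre_digraph \<Rightarrow> bool" where
  "bipartite G \<longleftrightarrow> (\<exists>U W. pverts G = U \<union> W \<and> U \<inter> W = {} \<and> parcs G \<subseteq> U \<times> W \<union> W \<times> U)"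

text \<open>The values \<open>c i\<close>, \<open>a i\<close>, \<open>b i\<close> count the neighbours of \<open>v\<close> at distance
  \<open>i - 1\<close>, \<open>i\<close>, \<open>i + 1\<close> from \<open>u\<close>, where \<open>i\<close> is the distance of \<open>u\<close> and \<open>v\<close>. The first
  condition is written additively because \<open>i - 1\<close> truncates for \<open>i = 0\<close>; thus \<open>c 0 = 0\<close>.
  That \<open>b d = 0\<close> and that \<open>G\<close> is regular of degree \<open>b 0 = a i + b i + c i\<close> follow.
  The values of \<open>a\<close>, \<open>b\<close>, \<open>c\<close> beyond the diameter are unconstrained and never used.\<close>

definition distance_regular ::
    "'a pair_pre_digraph \<Rightarrow> nat \<Rightarrow> (nat \<Rightarrow> nat) \<Rightarrow> (nat \<Rightarrow> nat) \<Rightarrow> (nat \<Rightarrow> nat) \<Rightarrow> bool" where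
  "distance_regular G d a b c \<longleftrightarrow>
     pair_graph G \<and> Digraph_Component.connected (with_proj G) \<and> graph_diameter G = d \<and>
     (\<forall>u \<in> pverts G. \<forall>v \<in> pverts G.
        card {w. (v, w) \<in> parcs G \<and> graph_dist G u w + 1 = graph_dist G u v} = c (graph_dist G u v) \<and>
        card {w. (v, w) \<in> parcs G \<and> graph_dist G u w = graph_dist G u v} = a (graph_dist G u v) \<and>
        card {w. (v, w) \<in> parcs G \<and> graph_dist G u w = graph_dist G u v + 1} = b (graph_dist G u v))"

definition token_graph2 :: "'a pair_pre_digraph \<Rightarrow> 'a set pair_pre_digraph" where
  "token_graph2 G =
     (let P = {A. A \<subseteq> pverts G \<and> card A = 2} in
      \<lparr> pverts = P,
        parcs = {(A, B). A \<in> P \<and> B \<in> P \<and>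
                   (\<exists>a \<in> A. \<exists>b \<in> B. (A - B) \<union> (B - A) = {a, b} \<and> (a, b) \<in> parcs G)} \<rparr>)"

text \<open>Graph matrices, with rows and columns ordered by a list \<open>vs\<close> enumerating the vertices
  without repetition.\<close>

definition adjacency_matrix :: "'v pair_pre_digraph \<Rightarrow> 'v list \<Rightarrow> real mat" where
  "adjacency_matrix G vs = mat (length vs) (length vs)
     (\<lambda>(i, j). if (vs ! i, vs ! j) \<in> parcs G then 1 else 0)"

definition degree_matrix :: "'v pair_pre_digraph \<Rightarrow> 'v list \<Rightarrow> real mat" where
  "degree_matrix G vs = mat (length vs) (length vs)
     (\<lambda>(i, j). if i = j then real (out_degree (with_proj G) (vs ! i)) else 0)"

definition laplacian_matrix :: "'v pair_pre_digraph \<Rightarrow> 'v list \<Rightarrow> real mat" where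
  "laplacian_matrix G vs = degree_matrix G vs - adjacency_matrix G vs"

text \<open>All matrices to which this is applied have only real eigenvalues: they are symmetric, or
  tridiagonal with the two entries in positions \<open>(i, i + 1)\<close> and \<open>(i + 1, i)\<close> nonzero
  and of the same sign.\<close>

definition largest_eigenvalue :: "real mat \<Rightarrow> real" where
  "largest_eigenvalue A = Max (spectrum A)"

text \<open>The quotient matrices, whose rows and columns are indexed by \<open>1, \<dots>, d\<close> on paper:
  the matrix index \<open>i < d\<close> stands for \<open>Suc i\<close>.\<close>

definition quotient_adjacency ::
    "nat \<Rightarrow> (nat \<Rightarrow> nat) \<Rightarrow> (nat \<Rightarrow> nat) \<Rightarrow> (nat \<Rightarrow> nat) \<Rightarrow> real mat" where
  "quotient_adjacency d a b c = mat d d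
     (\<lambda>(i, j). if j = i then 2 * real (a (Suc i))
               else if j = Suc i then 2 * real (b (Suc i))
               else if i = Suc j then 2 * real (c (Suc i))
               else 0)"

text \<open>The diagonal makes all row sums zero: there is no \<open>c\<close>-term in the first row and no
  \<open>b\<close>-term in the last one. For \<open>d = 1\<close> this is the zero matrix.\<close>

definition quotient_laplacian :: "nat \<Rightarrow> (nat \<Rightarrow> nat) \<Rightarrow> (nat \<Rightarrow> nat) \<Rightarrow> real mat" where
  "quotient_laplacian d b c = mat d d
     (\<lambda>(i, j). if j = i then 2 * ((if i = 0 then 0 else real (c (Suc i))) +
                                  (if Suc i = d then 0 else real (b (Suc i))))
               else if j = Suc i then - 2 * real (b (Suc i))
               else if i = Suc j then - 2 * real (c (Suc i))
               else 0)"

end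

theory Submission
  imports Defs "HOL-Analysis.Function_Topology"
begin

text \<open>The partition \<open>\<pi>\<close> of the pairs of vertices by their distance is equitable for both matrices
  of the token graph, so eigenvectors of a quotient matrix \<open>Q\<close> lift to eigenvectors of the token
  matrix \<open>M\<close>, constant on classes. Conversely, summing an eigenvector of \<open>M\<close> over the
  classes yields an eigenvector of the transpose of \<open>Q\<close>, provided the sums do not all vanish.
  For the adjacency matrix, some leading eigenvector is nonnegative, so they do not vanish. If \<open>G\<close> is
  bipartite, an arc of the token graph changes the parity of the distance, so the Laplacian
  conjugated by the signs \<open>(-1)^dist\<close> has nonnegative off-diagonal entries, and some leading
  eigenvector has the sign \<open>(-1)^dist\<close> throughout; again its class sums do not all vanish.\<close>

section \<open>Leading eigenvectors of symmetric matrices\<close>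

text \<open>Eigenvectors become plain functions on indices, so that composing them with a class map
  and regrouping sums by classes need no vector carriers.\<close>

lemma mem_spectrum_iff:
  fixes A :: "'a :: comm_ring_1 mat"
  assumes A: "A \<in> carrier_mat n n"
  shows "k \<in> spectrum A \<longleftrightarrow>
    (\<exists>f. (\<exists>i<n. f i \<noteq> 0) \<and> (\<forall>i<n. (\<Sum>j<n. A $$ (i, j) * f j) = k * f i))"
proof
  assume "k \<in> spectrum A"
  then obtain v where v: "v \<in> carrier_vec n" "v \<noteq> 0\<^sub>v n" "A *\<^sub>v v = k \<cdot>\<^sub>v v"
    using A by (auto simp: spectrum_def eigenvalue_def eigenvector_def)
  have "(\<Sum>j<n. A $$ (i, j) * vec_index v j) = k * vec_index v i" if "i < n" for i
    using arg_cong[OF v(3), of "\<lambda>w. vec_index w i"] that v(1) A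
    by (simp add: scalar_prod_def lessThan_atLeast0)
  moreover have "\<exists>i<n. vec_index v i \<noteq> 0"
    using v(1,2) by (metis carrier_vecD eq_vecI index_zero_vec)
  ultimately show "\<exists>f. (\<exists>i<n. f i \<noteq> 0) \<and> (\<forall>i<n. (\<Sum>j<n. A $$ (i, j) * f j) = k * f i)"
    by blast
next
  assume "\<exists>f. (\<exists>i<n. f i \<noteq> 0) \<and> (\<forall>i<n. (\<Sum>j<n. A $$ (i, j) * f j) = k * f i)"
  then obtain f i where f: "i < n" "f i \<noteq> 0"
      "\<And>i. i < n \<Longrightarrow> (\<Sum>j<n. A $$ (i, j) * f j) = k * f i"
    by blast
  have "A *\<^sub>v vec n f = k \<cdot>\<^sub>v vec n f"
    by (rule eq_vecI) (use A f(3) in \<open>auto simp: scalar_prod_def lessThan_atLeast0\<close>)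
  moreover have "vec n f \<noteq> 0\<^sub>v n"
    using f(1,2) by (metis index_vec index_zero_vec(1))
  ultimately show "k \<in> spectrum A"
    using A by (auto simp: spectrum_def eigenvalue_def eigenvector_def intro!: exI[of _ "vec n f"])
qed

text \<open>A matrix and its transpose share their characteristic polynomial. Class sums produce
  eigenvectors of the transposed quotient, and this brings them back.\<close>

lemma spectrum_transpose_mat:
  fixes A :: "'a :: field mat"
  assumes "A \<in> carrier_mat n n"
  shows "spectrum (transpose_mat A) = spectrum A"
  using assms
  by (simp add: spectrum_root_char_poly[of A n] spectrum_root_char_poly[of "transpose_mat A" n])

text \<open>The unit sphere is compact, so the form has a maximum \<open>m\<close> there;
  homogeneity of degree two spreads the bound to all vectors.\<close>

lemma quadratic_form_attains_max:
  fixes M :: "nat \<Rightarrow> nat \<Rightarrow> real"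
  assumes "n > 0"
  obtains x :: "nat \<Rightarrow> real" and m where "(\<Sum>i<n. (x i)\<^sup>2) = 1"
    "(\<Sum>i<n. \<Sum>j<n. M i j * x i * x j) = m"
    "\<And>y :: nat \<Rightarrow> real. (\<Sum>i<n. \<Sum>j<n. M i j * y i * y j) \<le> m * (\<Sum>i<n. (y i)\<^sup>2)"
proof -
  define q where "q = (\<lambda>y :: nat \<Rightarrow> real. \<Sum>i<n. \<Sum>j<n. M i j * y i * y j)"
  define s where "s = (\<lambda>y :: nat \<Rightarrow> real. \<Sum>i<n. (y i)\<^sup>2)"
  \<comment> \<open>Pinning the coordinates from \<open>n\<close> on to 0 embeds the cube of
    dimension \<open>n\<close> into \<open>nat => real\<close> as a product of compact factors. The
    sphere \<open>K\<close> is a closed part of it.\<close>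
  define B where "B = PiE UNIV (\<lambda>i. if i < n then {-1..1::real} else {0})"
  define K where "K = B \<inter> {y. s y = 1}"
  have "compactin (product_topology (\<lambda>i. euclidean) UNIV) B"
    unfolding B_def compactin_PiE by (auto simp: compactin_euclidean_iff)
  then have "compact B"
    by (simp add: euclidean_product_topology compactin_euclidean_iff)
  moreover have "closed {y. s y = 1}"
    unfolding s_def by (intro closed_Collect_eq continuous_intros) auto
  ultimately have "compact K"
    unfolding K_def by (rule compact_Int_closed)
  \<comment> \<open>The first unit vector shows that \<open>K\<close> is nonempty; this is where
    \<open>n > 0\<close> enters.\<close>
  moreover have "(\<lambda>i. if i = 0 then 1 else 0) \<in> K"
    using assms by (auto simp: K_def B_def s_def if_distrib[of "\<lambda>x. x\<^sup>2"] cong: if_cong)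
  moreover have "continuous_on K q"
    unfolding q_def by (intro continuous_intros) (auto intro: continuous_on_subset[OF continuous_on_product_coordinates])
  ultimately obtain x where x: "x \<in> K" "\<And>y. y \<in> K \<Longrightarrow> q y \<le> q x"
    using continuous_attains_sup[of K q] by blast
  have "q y \<le> q x * s y" for y
  proof (cases "s y = 0")
    case True
    then have "y i = 0" if "i < n" for i
      using that by (simp add: s_def sum_nonneg_eq_0_iff)
    then show ?thesis
      using True by (simp add: q_def)
  next
    case False
    define r where "r = sqrt (s y)"
    have s: "s y > 0"
      using False by (simp add: s_def sum_nonneg order_less_le)
    then have r: "r > 0" "r\<^sup>2 = s y"
      by (simp_all add: r_def)
    \<comment> \<open>Rescaling \<open>y\<close> to norm 1 and cutting it off at \<open>n\<close>
      puts it into \<open>K\<close>; \<open>q\<close> and \<open>s\<close> see only indices below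
      \<open>n\<close>.\<close>
    define z where "z = (\<lambda>i. if i < n then y i / r else 0)"
    have sz: "s z = s y / r\<^sup>2" 
      by (simp add: s_def z_def power_divide sum_divide_distrib)
    have qz: "q z = q y / r\<^sup>2"
      by (simp add: q_def z_def sum_divide_distrib power2_eq_square)
    have "\<bar>z i\<bar> \<le> 1" if "i < n" for i
    proof -
      have "(z i)\<^sup>2 \<le> s z"
        unfolding s_def using that by (intro member_le_sum) auto
      then show ?thesis
        using sz r s by (simp add: abs_square_le_1)
    qed
    then have "-1 \<le> z i \<and> z i \<le> 1" if "i < n" for i
      using that by (simp add: abs_le_iff minus_le_iff)
    moreover have "z i = 0" if "\<not> i < n" for i
      using that by (simp add: z_def)
    ultimately have "z \<in> B"
      by (simp add: B_def PiE_iff)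
    then have "z \<in> K"
      using sz r s by (simp add: K_def)
    from x(2)[OF this] show ?thesis
      using qz r s by (simp add: field_simps)
  qed
  then show thesis
    using that[of x "q x"] x(1) by (simp add: K_def s_def q_def)
qed

text \<open>\<open>m |y|\<^sup>2 - y\<^sup>T M y\<close> is a positive semidefinite form, so an isotropic vector lies in its
  radical.\<close>

lemma quadratic_form_maximizer_eigenvector:
  fixes M :: "nat \<Rightarrow> nat \<Rightarrow> real"
  assumes sym: "\<And>i j. i < n \<Longrightarrow> j < n \<Longrightarrow> M i j = M j i"
    and max: "\<And>y :: nat \<Rightarrow> real. (\<Sum>i<n. \<Sum>j<n. M i j * y i * y j) \<le> m * (\<Sum>i<n. (y i)\<^sup>2)"
    and attained: "m * (\<Sum>i<n. (x i)\<^sup>2) \<le> (\<Sum>i<n. \<Sum>j<n. M i j * x i * x j)"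
    and "k < n"
  shows "(\<Sum>j<n. M k j * x j) = m * x k"
proof (rule ccontr)
  define r where "r = (\<Sum>j<n. M k j * x j) - m * x k"
  define c where "c = M k k - m"
  define e :: "nat \<Rightarrow> real" where "e = (\<lambda>i. if i = k then 1 else 0)"
  assume "(\<Sum>j<n. M k j * x j) \<noteq> m * x k"
  then have "r \<noteq> 0" by (simp add: r_def)
  have e: "(\<Sum>i<n. f i * e i) = f k" for f :: "nat \<Rightarrow> real"
    using \<open>k < n\<close> by (simp add: e_def if_distrib[of "\<lambda>x. _ * x"] cong: if_cong)
  have col: "(\<Sum>i<n. M i k * x i) = (\<Sum>j<n. M k j * x j)"
    using sym \<open>k < n\<close> by (intro sum.cong) auto
  \<comment> \<open>Moving from \<open>x\<close> to \<open>x + t * e\<close> cannot push the form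
    above the bound \<open>m\<close>, which is attained at \<open>x\<close>. The constant terms drop
    out, leaving a polynomial in \<open>t\<close> with linear coefficient
    \<open>2 * r\<close>.\<close>
  have key: "2 * t * r + t\<^sup>2 * c \<le> 0" for t
  proof -
    have "(\<Sum>i<n. \<Sum>j<n. M i j * (x i + t * e i) * (x j + t * e j)) =
        (\<Sum>i<n. \<Sum>j<n. M i j * x i * x j) + t * (\<Sum>i<n. \<Sum>j<n. (M i j * x i) * e j)
        + t * (\<Sum>i<n. (\<Sum>j<n. M i j * x j) * e i) + t\<^sup>2 * (\<Sum>i<n. (\<Sum>j<n. M i j * e j) * e i)"
      by (simp add: sum.distrib sum_distrib_left sum_distrib_right algebra_simps power2_eq_square)
    also have "\<dots> = (\<Sum>i<n. \<Sum>j<n. M i j * x i * x j) + 2 * t * (\<Sum>j<n. M k j * x j) + t\<^sup>2 * M k k"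
      by (simp only: e col)
    finally have lhs: "(\<Sum>i<n. \<Sum>j<n. M i j * (x i + t * e i) * (x j + t * e j)) =
      (\<Sum>i<n. \<Sum>j<n. M i j * x i * x j) + 2 * t * (\<Sum>j<n. M k j * x j) + t\<^sup>2 * M k k" .
    have "(\<Sum>i<n. (x i + t * e i)\<^sup>2) =
        (\<Sum>i<n. (x i)\<^sup>2) + 2 * t * (\<Sum>i<n. x i * e i) + t\<^sup>2 * (\<Sum>i<n. e i * e i)"
      by (simp add: sum.distrib sum_distrib_left algebra_simps power2_eq_square)
    also have "\<dots> = (\<Sum>i<n. (x i)\<^sup>2) + 2 * t * x k + t\<^sup>2"
      by (simp only: e) (simp add: e_def)
    finally have rhs: "(\<Sum>i<n. (x i + t * e i)\<^sup>2) = (\<Sum>i<n. (x i)\<^sup>2) + 2 * t * x k + t\<^sup>2" .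
    show ?thesis
      using max[of "\<lambda>i. x i + t * e i"] attained unfolding lhs rhs
      by (simp add: r_def c_def algebra_simps)
  qed
  \<comment> \<open>With \<open>t = r / h\<close> and \<open>h\<close> exceeding the size of
    \<open>c\<close>, the linear term beats the quadratic one: the value is at least
    \<open>r^2 / h > 0\<close>.\<close>
  define h where "h = 1 + \<bar>c\<bar>"
  have "h > 0" "c \<ge> - h" by (auto simp: h_def)
  define t where "t = r / h"
  have "2 * t * r + t\<^sup>2 * c = r\<^sup>2 / h * (2 + c / h)"
    using \<open>h > 0\<close> by (simp add: t_def power2_eq_square field_simps)
  moreover have "c / h \<ge> -1"
    using \<open>h > 0\<close> \<open>c \<ge> - h\<close> by (simp add: field_simps)
  ultimately have "2 * t * r + t\<^sup>2 * c > 0"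
    using \<open>r \<noteq> 0\<close> \<open>h > 0\<close> by (simp add: zero_less_mult_iff divide_pos_pos)
  with key[of t] show False by simp
qed

lemma spectrum_le_largest_eigenvalue:
  assumes "A \<in> carrier_mat n n" "k \<in> spectrum A"
  shows "k \<le> largest_eigenvalue A"
  unfolding largest_eigenvalue_def using assms card_finite_spectrum(1) by (intro Max_ge) auto

text \<open>A real matrix may have no real eigenvalue, and \<open>Max\<close> of the empty set is
  unspecified; hence the nonemptiness assumption, which recurs below for quotients.\<close>

lemma largest_eigenvalue_in_spectrum:
  assumes "A \<in> carrier_mat n n" "spectrum A \<noteq> {}"
  shows "largest_eigenvalue A \<in> spectrum A"
  unfolding largest_eigenvalue_def using assms card_finite_spectrum(1) by (intro Max_in) auto

text \<open>Replacing \<open>x i\<close> by \<open>s i * \<bar>x i\<bar>\<close> does not decrease the quadratic form.\<close>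

lemma signed_leading_eigenvector:
  fixes M :: "real mat" and s :: "nat \<Rightarrow> real"
  assumes M: "M \<in> carrier_mat n n" and "n > 0"
    and sym: "\<And>i j. i < n \<Longrightarrow> j < n \<Longrightarrow> M $$ (i, j) = M $$ (j, i)"
    and s: "\<And>i. i < n \<Longrightarrow> \<bar>s i\<bar> = 1"
    and nonneg: "\<And>i j. i < n \<Longrightarrow> j < n \<Longrightarrow> i \<noteq> j \<Longrightarrow> s i * s j * M $$ (i, j) \<ge> 0"
  obtains y where "\<And>i. i < n \<Longrightarrow> y i \<ge> 0" "\<exists>i<n. y i \<noteq> 0"
    "\<And>i. i < n \<Longrightarrow> (\<Sum>j<n. M $$ (i, j) * (s j * y j)) = largest_eigenvalue M * (s i * y i)"
proof -
  obtain x :: "nat \<Rightarrow> real" and m where x: "(\<Sum>i<n. (x i)\<^sup>2) = 1"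
    "(\<Sum>i<n. \<Sum>j<n. M $$ (i, j) * x i * x j) = m"
    and max: "\<And>y :: nat \<Rightarrow> real.
      (\<Sum>i<n. \<Sum>j<n. M $$ (i, j) * y i * y j) \<le> m * (\<Sum>i<n. (y i)\<^sup>2)"
    using quadratic_form_attains_max[OF \<open>n > 0\<close>, of "\<lambda>i j. M $$ (i, j)"] by blast
  define z where "z = (\<lambda>i. s i * \<bar>x i\<bar>)"
  have zz: "z i * z i = x i * x i" if "i < n" for i
  proof -
    have "z i * z i = (s i * s i) * (x i * x i)"
      by (simp add: z_def ac_simps)
    moreover have "s i * s i = 1"
      using s[OF that] by (metis abs_mult_self_eq mult_1)
    ultimately show ?thesis by simp
  qed
  \<comment> \<open>Diagonal terms agree because \<open>z\<close> and \<open>x\<close> have equal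
    squares; off the diagonal the sign condition turns the term of \<open>z\<close> into the
    absolute value of that of \<open>x\<close>.\<close>
  have "M $$ (i, j) * x i * x j \<le> M $$ (i, j) * z i * z j" if "i < n" "j < n" for i j
  proof (cases "i = j")
    case True
    then show ?thesis using zz[OF that(1)] by (simp add: mult.assoc)
  next
    case False
    have "s i * s j * M $$ (i, j) = \<bar>M $$ (i, j)\<bar>"
      using abs_of_nonneg[OF nonneg[OF that False]] s[OF that(1)] s[OF that(2)]
      by (simp add: abs_mult)
    moreover have "M $$ (i, j) * z i * z j = (s i * s j * M $$ (i, j)) * (\<bar>x i\<bar> * \<bar>x j\<bar>)"
      by (simp add: z_def ac_simps)
    ultimately have "M $$ (i, j) * z i * z j = \<bar>M $$ (i, j) * x i * x j\<bar>"
      by (simp add: abs_mult)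
    then show ?thesis by simp
  qed
  then have "m \<le> (\<Sum>i<n. \<Sum>j<n. M $$ (i, j) * z i * z j)"
    unfolding x(2)[symmetric] by (intro sum_mono) simp
  moreover have z2: "(\<Sum>i<n. (z i)\<^sup>2) = 1"
    using x(1) by (simp add: zz power2_eq_square)
  \<comment> \<open>\<open>z\<close> is a unit vector at which the form is at least
    \<open>m\<close>, so it is a maximizer as well.\<close>
  ultimately have eig: "(\<Sum>j<n. M $$ (i, j) * z j) = m * z i" if "i < n" for i
    using that by (intro quadratic_form_maximizer_eigenvector[OF sym max]) auto
  have nz: "\<exists>i<n. x i \<noteq> 0"
    using x(1) by (rule_tac ccontr) (auto simp: sum.neutral)
  have "m \<in> spectrum M"
  proof -
    obtain i where "i < n" "x i \<noteq> 0" using nz by blast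
    then have "z i \<noteq> 0" using zz[of i] by auto
    then show ?thesis using eig \<open>i < n\<close> unfolding mem_spectrum_iff[OF M] by blast
  qed
  \<comment> \<open>Rayleigh bound: on an eigenvector \<open>f\<close> the form equals
    \<open>k\<close> times the squared norm.\<close>
  moreover have "k \<le> m" if k: "k \<in> spectrum M" for k
  proof -
    obtain f i where f: "i < n" "f i \<noteq> 0" "\<And>i. i < n \<Longrightarrow> (\<Sum>j<n. M $$ (i, j) * f j) = k * f i"
      using k unfolding mem_spectrum_iff[OF M] by blast
    have "k * (\<Sum>i<n. (f i)\<^sup>2) = (\<Sum>i<n. (k * f i) * f i)"
      by (simp add: sum_distrib_left power2_eq_square mult.assoc)
    also have "\<dots> = (\<Sum>i<n. \<Sum>j<n. M $$ (i, j) * f i * f j)"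
      using f(3)[symmetric] by (simp add: sum_distrib_right sum_distrib_left ac_simps)
    also have "\<dots> \<le> m * (\<Sum>i<n. (f i)\<^sup>2)" by (rule max)
    finally have "k * (\<Sum>i<n. (f i)\<^sup>2) \<le> m * (\<Sum>i<n. (f i)\<^sup>2)" .
    moreover have "(\<Sum>i<n. (f i)\<^sup>2) > 0"
      using f(1,2) by (intro sum_pos2[of _ i]) auto
    ultimately show ?thesis by simp
  qed
  ultimately have "largest_eigenvalue M = m"
    unfolding largest_eigenvalue_def using card_finite_spectrum(1)[OF M] by (intro Max_eqI) auto
  then show thesis
    using that[of "\<lambda>i. \<bar>x i\<bar>"] nz eig by (auto simp: z_def)
qed

section \<open>Equitable partitions\<close>

lemma sum_over_classes:
  fixes \<kappa> :: "nat \<Rightarrow> nat" and g :: "nat \<Rightarrow> 'b :: comm_monoid_add"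
  assumes "\<And>i. i < n \<Longrightarrow> \<kappa> i < d"
  shows "(\<Sum>k<d. \<Sum>i | i < n \<and> \<kappa> i = k. g i) = (\<Sum>i<n. g i)"
  using sum.group[of "{..<n}" "{..<d}" \<kappa> g] assms by (auto simp: lessThan_def)

text \<open>Row sums of \<open>M\<close> over a class depend only on the class of the row, so
  applying \<open>M\<close> to \<open>f\<close> composed with \<kappa> amounts to applying
  \<open>Q\<close> to \<open>f\<close>. Surjectivity of \<kappa> keeps the lift nonzero.\<close>

lemma quotient_spectrum_subset:
  fixes M Q :: "'a :: comm_ring_1 mat"
  assumes M: "M \<in> carrier_mat n n" and Q: "Q \<in> carrier_mat d d"
    and \<kappa>: "\<And>i. i < n \<Longrightarrow> \<kappa> i < d"
    and surj: "\<And>k. k < d \<Longrightarrow> \<exists>i<n. \<kappa> i = k"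
    and equitable: "\<And>i k. i < n \<Longrightarrow> k < d \<Longrightarrow>
      (\<Sum>j | j < n \<and> \<kappa> j = k. M $$ (i, j)) = Q $$ (\<kappa> i, k)"
  shows "spectrum Q \<subseteq> spectrum M"
proof
  fix l assume "l \<in> spectrum Q"
  then obtain f where nz: "\<exists>k<d. f k \<noteq> 0"
    and f: "\<And>k. k < d \<Longrightarrow> (\<Sum>j<d. Q $$ (k, j) * f j) = l * f k"
    unfolding mem_spectrum_iff[OF Q] by blast
  have "(\<Sum>j<n. M $$ (i, j) * f (\<kappa> j)) = l * f (\<kappa> i)" if "i < n" for i
  proof -
    have "(\<Sum>j<n. M $$ (i, j) * f (\<kappa> j)) = (\<Sum>k<d. \<Sum>j | j < n \<and> \<kappa> j = k. M $$ (i, j) * f (\<kappa> j))"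
      by (rule sum_over_classes[symmetric]) (rule \<kappa>)
    also have "\<dots> = (\<Sum>k<d. Q $$ (\<kappa> i, k) * f k)"
      using that by (intro sum.cong) (simp_all add: equitable[symmetric] sum_distrib_right)
    finally show ?thesis using f \<kappa> that by simp
  qed
  moreover have "\<exists>i<n. f (\<kappa> i) \<noteq> 0" using nz surj by metis
  ultimately show "l \<in> spectrum M" 
    unfolding mem_spectrum_iff[OF M] by (intro exI[of _ "\<lambda>i. f (\<kappa> i)"]) blast
qed

lemma quotient_largest_eigenvalue_le:
  fixes M Q :: "real mat"
  assumes M: "M \<in> carrier_mat n n" and Q: "Q \<in> carrier_mat d d" and "spectrum Q \<noteq> {}"
    and "\<And>i. i < n \<Longrightarrow> \<kappa> i < d" "\<And>k. k < d \<Longrightarrow> \<exists>i<n. \<kappa> i = k"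
    and "\<And>i k. i < n \<Longrightarrow> k < d \<Longrightarrow>
      (\<Sum>j | j < n \<and> \<kappa> j = k. M $$ (i, j)) = Q $$ (\<kappa> i, k)"
  shows "largest_eigenvalue Q \<le> largest_eigenvalue M"
  using spectrum_le_largest_eigenvalue[OF M] largest_eigenvalue_in_spectrum[OF Q]
    quotient_spectrum_subset[OF M Q, of \<kappa>] assms by blast

text \<open>The class sums of the signed leading eigenvector of \<open>M\<close> do not cancel, since the sign is
  constant on classes; they form an eigenvector of the transpose of \<open>Q\<close>.\<close>

lemma quotient_largest_eigenvalue_eq:
  fixes M Q :: "real mat" and s :: "nat \<Rightarrow> real"
  assumes M: "M \<in> carrier_mat n n" and Q: "Q \<in> carrier_mat d d" and "n > 0"
    and \<kappa>: "\<And>i. i < n \<Longrightarrow> \<kappa> i < d"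
    and surj: "\<And>k. k < d \<Longrightarrow> \<exists>i<n. \<kappa> i = k"
    and equitable: "\<And>i k. i < n \<Longrightarrow> k < d \<Longrightarrow>
      (\<Sum>j | j < n \<and> \<kappa> j = k. M $$ (i, j)) = Q $$ (\<kappa> i, k)"
    and sym: "\<And>i j. i < n \<Longrightarrow> j < n \<Longrightarrow> M $$ (i, j) = M $$ (j, i)"
    and s: "\<And>k. k < d \<Longrightarrow> \<bar>s k\<bar> = 1"
    and nonneg: "\<And>i j. i < n \<Longrightarrow> j < n \<Longrightarrow> i \<noteq> j \<Longrightarrow> s (\<kappa> i) * s (\<kappa> j) * M $$ (i, j) \<ge> 0"
  shows "largest_eigenvalue M = largest_eigenvalue Q"
proof -
  define m where "m = largest_eigenvalue M"
  obtain y where y: "\<And>i. i < n \<Longrightarrow> y i \<ge> 0" "\<exists>i<n. y i \<noteq> 0"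
    and eig: "\<And>i. i < n \<Longrightarrow> (\<Sum>j<n. M $$ (i, j) * (s (\<kappa> j) * y j)) = m * (s (\<kappa> i) * y i)"
    using signed_leading_eigenvector[OF M \<open>n > 0\<close> sym, of "\<lambda>i. s (\<kappa> i)"] s \<kappa> nonneg
    unfolding m_def by blast
  define v where "v = (\<lambda>i. s (\<kappa> i) * y i)"
  define w where "w = (\<lambda>k. \<Sum>i | i < n \<and> \<kappa> i = k. v i)"
  have QT: "transpose_mat Q \<in> carrier_mat d d" using Q by simp
  have "(\<Sum>k<d. transpose_mat Q $$ (l, k) * w k) = m * w l" if "l < d" for l
  proof -
    have "(\<Sum>k<d. transpose_mat Q $$ (l, k) * w k) =
        (\<Sum>k<d. \<Sum>i | i < n \<and> \<kappa> i = k. Q $$ (\<kappa> i, l) * v i)"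
      using that Q by (intro sum.cong) (simp_all add: w_def sum_distrib_left)
    also have "\<dots> = (\<Sum>i<n. Q $$ (\<kappa> i, l) * v i)"
      by (rule sum_over_classes) (rule \<kappa>)
    \<comment> \<open>Equitability is read backwards: each entry of \<open>Q\<close> is expanded
      into a row sum of \<open>M\<close>. After the swap, symmetry of \<open>M\<close> turns column
      sums into row sums, to which the eigenvector equation applies.\<close>
    also have "\<dots> = (\<Sum>i<n. \<Sum>j | j < n \<and> \<kappa> j = l. M $$ (i, j) * v i)"
      using that by (intro sum.cong) (simp_all add: equitable[symmetric] sum_distrib_right)
    also have "\<dots> = (\<Sum>j | j < n \<and> \<kappa> j = l. \<Sum>i<n. M $$ (i, j) * v i)"
      by (rule sum.swap)
    also have "\<dots> = (\<Sum>j | j < n \<and> \<kappa> j = l. m * v j)"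
    proof (rule sum.cong[OF refl], clarify)
      fix j assume "j < n"
      then have "(\<Sum>i<n. M $$ (i, j) * v i) = (\<Sum>i<n. M $$ (j, i) * v i)"
        using sym by (intro sum.cong) auto
      then show "(\<Sum>i<n. M $$ (i, j) * v i) = m * v j"
        using eig[OF \<open>j < n\<close>] by (simp add: v_def)
    qed
    finally show ?thesis by (simp add: w_def sum_distrib_left)
  qed
  moreover have "\<exists>k<d. w k \<noteq> 0"
  proof -
    obtain i where i: "i < n" "y i \<noteq> 0" using y(2) by blast
    have "w (\<kappa> i) = s (\<kappa> i) * (\<Sum>j | j < n \<and> \<kappa> j = \<kappa> i. y j)"
      by (simp add: w_def v_def sum_distrib_left)
    moreover have "(\<Sum>j | j < n \<and> \<kappa> j = \<kappa> i. y j) > 0"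
      using i y(1) by (intro sum_pos2[of _ i]) (auto simp: order_less_le)
    ultimately show ?thesis using s[of "\<kappa> i"] \<kappa> i(1) by (intro exI[of _ "\<kappa> i"]) auto
  qed
  ultimately have "m \<in> spectrum Q"
    unfolding spectrum_transpose_mat[OF Q, symmetric] mem_spectrum_iff[OF QT] by blast
  \<comment> \<open>Membership of \<open>m\<close> also supplies the nonempty spectrum of
    \<open>Q\<close> that the inequality demands.\<close>
  moreover from this have "largest_eigenvalue Q \<le> m"
    unfolding m_def
    using quotient_largest_eigenvalue_le[OF M Q _ \<kappa> surj equitable] by blast
  ultimately show ?thesis
    using spectrum_le_largest_eigenvalue[OF Q] unfolding m_def by (meson order_antisym)
qed

section \<open>Distances\<close>

text \<open>Powers of the arc relation are easier to extend, split and reverse than arc lists. For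
  \<open>n = 0\<close>, the empty walk requires \<open>u\<close> to be a vertex.\<close>

lemma (in pair_wf_digraph) ex_awalk_iff_relpow:
  "u \<in> pverts G \<Longrightarrow> (\<exists>p. awalk u p v \<and> length p = n) \<longleftrightarrow> (u, v) \<in> parcs G ^^ n"
proof (induction n arbitrary: u)
  case 0
  then show ?case by (auto simp: awalk_Nil_iff)
next
  case (Suc n)
  show ?case
  proof
    assume "\<exists>p. awalk u p v \<and> length p = Suc n"
    then obtain e p where "awalk u (e # p) v" "length p = n"
      by (auto simp: length_Suc_conv)
    then have e: "(u, snd e) \<in> parcs G" "awalk (snd e) p v" "length p = n"
      by (auto simp: awalk_Cons_iff)
    then have "(snd e, v) \<in> parcs G ^^ n"
      using Suc.IH[of "snd e"] in_arcsD2 by blast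
    with e(1) show "(u, v) \<in> parcs G ^^ Suc n" by (rule relpow_Suc_I2)
  next
    assume "(u, v) \<in> parcs G ^^ Suc n"
    then obtain w where w: "(u, w) \<in> parcs G" "(w, v) \<in> parcs G ^^ n"
      by (rule relpow_Suc_E2)
    then obtain p where "awalk w p v" "length p = n"
      using Suc.IH[of w] in_arcsD2 by blast
    then have "awalk u ((u, w) # p) v \<and> length ((u, w) # p) = Suc n"
      using w by (simp add: awalk_Cons_iff)
    then show "\<exists>p. awalk u p v \<and> length p = Suc n" by blast
  qed
qed

locale connected_pair_graph = pair_graph +
  assumes connected_graph: "Digraph_Component.connected (with_proj G)"
begin

lemma parcs_sym: "(u, v) \<in> parcs G \<Longrightarrow> (v, u) \<in> parcs G"
  using pair_sym_arcs by (auto simp: symmetric_def sym_def)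

lemma pverts_nonempty: "pverts G \<noteq> {}"
  using connected_graph by (simp add: connected_def strongly_connected_def mk_symmetric_def)

lemma reachable_verts:
  assumes "u \<in> pverts G" "v \<in> pverts G"
  shows "\<exists>n. (u, v) \<in> parcs G ^^ n"
proof -
  \<comment> \<open>Connectedness is defined as strong connectedness of the symmetric closure, which
    adds nothing here.\<close>
  have "mk_symmetric (with_proj G) = G"
    by (rule pair_pre_digraph.equality) (auto simp: mk_symmetric_def parcs_sym)
  then have "u \<rightarrow>\<^sup>*\<^bsub>with_proj G\<^esub> v"
    using connected_graph assms by (auto simp: connected_def strongly_connected_def)
  then obtain p where "awalk u p v" by (auto simp: reachable_awalk)
  then show ?thesis using ex_awalk_iff_relpow[OF assms(1)] by blast
qed

lemma graph_dist_relpow: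
  assumes "u \<in> pverts G" "v \<in> pverts G"
  shows "(u, v) \<in> parcs G ^^ graph_dist G u v"
  unfolding graph_dist_def ex_awalk_iff_relpow[OF assms(1)]
  using reachable_verts[OF assms] by (rule LeastI_ex)

lemma graph_dist_le:
  assumes "u \<in> pverts G" "(u, v) \<in> parcs G ^^ n"
  shows "graph_dist G u v \<le> n"
  unfolding graph_dist_def ex_awalk_iff_relpow[OF assms(1)] using assms(2) by (rule Least_le)

lemma graph_dist_eq_0_iff:
  assumes "u \<in> pverts G" "v \<in> pverts G"
  shows "graph_dist G u v = 0 \<longleftrightarrow> u = v"
  using graph_dist_relpow[OF assms] graph_dist_le[OF assms(1), of v 0] by auto

lemma graph_dist_self [simp]: "u \<in> pverts G \<Longrightarrow> graph_dist G u u = 0"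
  by (simp add: graph_dist_eq_0_iff)

lemma relpow_parcs_sym: "(u, v) \<in> parcs G ^^ n \<Longrightarrow> (v, u) \<in> parcs G ^^ n"
proof (induction n arbitrary: v)
  case (Suc n)
  then show ?case by (metis parcs_sym relpow_Suc_E relpow_Suc_I2)
qed simp

lemma graph_dist_sym:
  assumes "u \<in> pverts G" "v \<in> pverts G"
  shows "graph_dist G u v = graph_dist G v u"
  using assms by (meson antisym graph_dist_le graph_dist_relpow relpow_parcs_sym)

lemma graph_dist_step_le:
  assumes "u \<in> pverts G" "(v, w) \<in> parcs G"
  shows "graph_dist G u w \<le> Suc (graph_dist G u v)"
  using assms by (meson graph_dist_le graph_dist_relpow in_arcsD1 relpow_Suc_I)

text \<open>Take the last but one vertex of a shortest walk: its distance is at most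
  \<open>k\<close> by the prefix, and at least \<open>k\<close> because one step adds at most
  1.\<close>

lemma graph_dist_predecessor:
  assumes "u \<in> pverts G" "v \<in> pverts G" "graph_dist G u v = Suc k"
  shows "\<exists>w. (w, v) \<in> parcs G \<and> graph_dist G u w = k"
proof -
  obtain w where w: "(u, w) \<in> parcs G ^^ k" "(w, v) \<in> parcs G"
    using graph_dist_relpow[OF assms(1,2)] assms(3) by (metis relpow_Suc_E)
  then have "graph_dist G u w = k"
    using graph_dist_le[OF assms(1) w(1)] graph_dist_step_le[OF assms(1) w(2)] assms(3) by simp
  with w(2) show ?thesis by blast
qed

lemma ex_vertex_at_smaller_dist:
  assumes "u \<in> pverts G" "v \<in> pverts G" "k \<le> graph_dist G u v"
  shows "\<exists>w \<in> pverts G. graph_dist G u w = k"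
  using assms(3,2)
proof (induction rule: inc_induct)
  case (step m)
  then show ?case by (metis assms(1) graph_dist_predecessor in_arcsD1)
qed blast

lemma graph_dist_le_diameter:
  assumes "u \<in> pverts G" "v \<in> pverts G"
  shows "graph_dist G u v \<le> graph_diameter G"
proof -
  have "finite ((\<lambda>(u, v). graph_dist G u v) ` (pverts G \<times> pverts G))"
    using pair_finite_verts by simp
  also have "(\<lambda>(u, v). graph_dist G u v) ` (pverts G \<times> pverts G) =
      {graph_dist G u v |u v. u \<in> pverts G \<and> v \<in> pverts G}"
    by auto
  finally show ?thesis unfolding graph_diameter_def using assms by (intro Max_ge) auto
qed

text \<open>No distance class up to the diameter is empty: start from a pair realizing the diameter
  and step back along predecessors. This makes the class map surjective.\<close>

lemma ex_vertices_at_dist: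
  assumes "k \<le> graph_diameter G"
  shows "\<exists>u \<in> pverts G. \<exists>v \<in> pverts G. graph_dist G u v = k"
proof -
  let ?D = "{graph_dist G u v |u v. u \<in> pverts G \<and> v \<in> pverts G}"
  have "finite ?D"
    using graph_dist_le_diameter by (intro finite_subset[of ?D "{..graph_diameter G}"]) auto
  moreover have "?D \<noteq> {}" using pverts_nonempty by auto
  ultimately have "graph_diameter G \<in> ?D"
    unfolding graph_diameter_def by (rule Max_in)
  then obtain u v where uv: "u \<in> pverts G" "v \<in> pverts G" "graph_dist G u v = graph_diameter G"
    by force
  then show ?thesis using ex_vertex_at_smaller_dist[OF uv(1,2), of k] assms by (auto intro: bexI[OF _ uv(1)])
qed

lemma bipartite_dist_parity:
  assumes "bipartite G" "u \<in> pverts G" "(v, w) \<in> parcs G"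
  shows "even (graph_dist G u v) \<longleftrightarrow> odd (graph_dist G u w)"
proof -
  obtain U W where UW: "pverts G = U \<union> W" "U \<inter> W = {}" "parcs G \<subseteq> U \<times> W \<union> W \<times> U"
    using assms(1) by (auto simp: bipartite_def)
  have side: "(x, y) \<in> parcs G \<Longrightarrow> x \<in> U \<longleftrightarrow> y \<notin> U" for x y
    using UW by blast
  \<comment> \<open>The parity of the length of any walk tells whether its ends lie on the same
    side; below, this is applied to shortest walks.\<close>
  have "(u, x) \<in> parcs G ^^ n \<Longrightarrow> (u \<in> U \<longleftrightarrow> x \<in> U) \<longleftrightarrow> even n" for n x
  proof (induction n arbitrary: x)
    case (Suc n)
    then obtain y where "(u, y) \<in> parcs G ^^ n" "(y, x) \<in> parcs G" by auto
    then show ?case using Suc.IH[of y] side[of y x] by auto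
  qed simp
  then show ?thesis
    using graph_dist_relpow[OF assms(2)] side[OF assms(3)] in_arcsD1[OF assms(3)] in_arcsD2[OF assms(3)]
    by metis
qed

end

section \<open>Token graphs\<close>

text \<open>For \<open>A = {u, v}\<close> this is the distance of \<open>u\<close> and \<open>v\<close>: the only other value of which the
  maximum is taken is \<open>0\<close>.\<close>

definition pair_dist :: "'a pair_pre_digraph \<Rightarrow> 'a set \<Rightarrow> nat" where
  "pair_dist G A = Max ((\<lambda>(u, v). graph_dist G u v) ` (A \<times> A))"

lemma pverts_token_graph2: "pverts (token_graph2 G) = {A. A \<subseteq> pverts G \<and> card A = 2}"
  by (simp add: token_graph2_def Let_def)

context connected_pair_graph
begin

lemma pair_dist_doubleton:
  assumes "u \<in> pverts G" "v \<in> pverts G"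
  shows "pair_dist G {u, v} = graph_dist G u v"
proof -
  have "(\<lambda>(u, v). graph_dist G u v) ` ({u, v} \<times> {u, v}) = {0, graph_dist G u v}"
    using assms graph_dist_sym[OF assms] by auto
  then show ?thesis by (simp add: pair_dist_def)
qed

lemma token_vertexE:
  assumes "A \<in> pverts (token_graph2 G)"
  obtains u v where "A = {u, v}" "u \<noteq> v" "u \<in> pverts G" "v \<in> pverts G"
  using assms by (auto simp: pverts_token_graph2 card_2_iff)

lemma pair_dist_bounds:
  assumes "A \<in> pverts (token_graph2 G)"
  shows "1 \<le> pair_dist G A" "pair_dist G A \<le> graph_diameter G"
proof -
  obtain u v where "A = {u, v}" "u \<noteq> v" "u \<in> pverts G" "v \<in> pverts G"
    using assms by (rule token_vertexE)
  then show "1 \<le> pair_dist G A" "pair_dist G A \<le> graph_diameter G"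
    using graph_dist_eq_0_iff[of u v] graph_dist_le_diameter[of u v]
    by (auto simp: pair_dist_doubleton)
qed

text \<open>One token moves along an edge while the other stays; the disjuncts say which one moves.
  The inequality on \<open>w\<close> keeps the moved token off the resting one.\<close>

lemma token_arc_iff:
  assumes "u \<noteq> v" "u \<in> pverts G" "v \<in> pverts G"
  shows "({u, v}, B) \<in> parcs (token_graph2 G) \<longleftrightarrow>
    (\<exists>w. w \<noteq> u \<and> (v, w) \<in> parcs G \<and> B = {u, w}) \<or> (\<exists>w. w \<noteq> v \<and> (u, w) \<in> parcs G \<and> B = {v, w})"
    (is "?L \<longleftrightarrow> ?R u v \<or> ?R v u")
proof
  assume ?L
  then obtain x y where xy: "x \<in> {u, v}" "y \<in> B" "({u, v} - B) \<union> (B - {u, v}) = {x, y}"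
      "(x, y) \<in> parcs G" and B: "card B = 2"
    by (auto simp: token_graph2_def Let_def)
  have "x \<noteq> y" using pair_no_loops[OF xy(4)] by simp
  have "x \<notin> B" "y \<notin> {u, v}" using xy(1-3) by blast+
  obtain z where z: "z \<in> {u, v}" "{u, v} = {x, z}" "z \<noteq> x" using xy(1) assms(1) by blast
  then have "z \<noteq> y" using \<open>y \<notin> {u, v}\<close> by blast
  \<comment> \<open>\<open>z\<close> is the resting token: outside \<open>B\<close> it would lie in
    the symmetric difference \<open>{x, y}\<close>.\<close>
  have "z \<in> B"
  proof (rule ccontr)
    assume "z \<notin> B"
    then have "z \<in> {x, y}" using xy(3) z(1) by blast
    then show False using \<open>z \<noteq> x\<close> \<open>z \<noteq> y\<close> by blast
  qed
  then have "{z, y} \<subseteq> B" "card {z, y} = card B" using xy(2) B \<open>z \<noteq> y\<close> by auto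
  moreover have "finite B" using B card.infinite by fastforce
  ultimately have "B = {z, y}" using card_subset_eq by metis
  then have "?R z x" using xy(4) \<open>z \<noteq> y\<close> by metis
  then show "?R u v \<or> ?R v u" using z by (auto simp: doubleton_eq_iff)
next
  have adj: "({x, y}, {x, w}) \<in> parcs (token_graph2 G)"
    if "x \<noteq> y" "x \<in> pverts G" "y \<in> pverts G" "w \<noteq> x" "(y, w) \<in> parcs G" for x y w
  proof -
    have "y \<noteq> w" "w \<in> pverts G" using pair_no_loops[OF that(5)] in_arcsD2[OF that(5)] by simp_all
    then show ?thesis using that
      by (auto simp: token_graph2_def Let_def intro!: bexI[of _ y] bexI[of _ w])
  qed
  assume "?R u v \<or> ?R v u"
  then show ?L
    using adj[of u v] adj[of v u] assms by (auto simp: insert_commute)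
qed

text \<open>Neighbours are sorted by the token that moves. Since \<open>k > 0\<close>, a token
  landing on the other one, at distance 0, is never counted.\<close>

lemma card_token_neighbours_at_dist:
  assumes uv: "u \<noteq> v" "u \<in> pverts G" "v \<in> pverts G" and "k > 0"
  shows "card {B. ({u, v}, B) \<in> parcs (token_graph2 G) \<and> pair_dist G B = k} =
    card {w. (v, w) \<in> parcs G \<and> graph_dist G u w = k} +
    card {w. (u, w) \<in> parcs G \<and> graph_dist G v w = k}"
proof -
  define N where "N = (\<lambda>x y. {w. (y, w) \<in> parcs G \<and> graph_dist G x w = k})"
  have finN: "finite (N x y)" for x y
    unfolding N_def using in_arcsD2 by (intro finite_subset[OF _ pair_finite_verts]) blast
  have *: "w \<noteq> x \<and> (y, w) \<in> parcs G \<and> pair_dist G {x, w} = k \<longleftrightarrow> w \<in> N x y"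
    if "x \<in> pverts G" for x y w
    using that \<open>k > 0\<close> in_arcsD2[of y w] pair_dist_doubleton[of x w] by (auto simp: N_def)
  have "{B. ({u, v}, B) \<in> parcs (token_graph2 G) \<and> pair_dist G B = k} =
      (\<lambda>w. {u, w}) ` N u v \<union> (\<lambda>w. {v, w}) ` N v u"
    unfolding token_arc_iff[OF uv] using *[OF uv(2), of _ v] *[OF uv(3), of _ u] by blast
  \<comment> \<open>A common element would force \<open>w = v\<close> in the first image, hence a
    loop at \<open>v\<close>.\<close>
  moreover have "(\<lambda>w. {u, w}) ` N u v \<inter> (\<lambda>w. {v, w}) ` N v u = {}"
    using uv(1) pair_no_loops by (fastforce simp: N_def doubleton_eq_iff)
  moreover have "inj_on (\<lambda>w. {x, w}) S" for x :: 'a and S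
    by (auto simp: inj_on_def doubleton_eq_iff)
  ultimately have "card {B. ({u, v}, B) \<in> parcs (token_graph2 G) \<and> pair_dist G B = k} =
      card (N u v) + card (N v u)"
    using finN by (simp add: card_Un_disjoint card_image)
  then show ?thesis by (simp add: N_def)
qed

lemma token_arc_parity:
  assumes "bipartite G" "(A, B) \<in> parcs (token_graph2 G)"
  shows "even (pair_dist G A) \<longleftrightarrow> odd (pair_dist G B)"
proof -
  have "A \<in> pverts (token_graph2 G)"
    using assms(2) by (auto simp: token_graph2_def Let_def)
  then obtain u v where uv: "A = {u, v}" "u \<noteq> v" "u \<in> pverts G" "v \<in> pverts G"
    by (rule token_vertexE)
  have *: "even (pair_dist G {x, y}) \<longleftrightarrow> odd (pair_dist G {x, w})"
    if "x \<in> pverts G" "y \<in> pverts G" "(y, w) \<in> parcs G" for x y w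
    using that in_arcsD2[OF that(3)] bipartite_dist_parity[OF assms(1) that(1,3)]
    by (simp add: pair_dist_doubleton)
  from assms(2) consider w where "(v, w) \<in> parcs G" "B = {u, w}" | w where "(u, w) \<in> parcs G" "B = {v, w}"
    unfolding uv(1) token_arc_iff[OF uv(2-4)] by blast
  then show ?thesis
  proof cases
    case 1
    then show ?thesis using *[OF uv(3,4)] uv(1) by simp
  next
    case 2
    then show ?thesis using *[OF uv(4,3)] uv(1) by (simp add: insert_commute)
  qed
qed

end

section \<open>Equitability of the distance classes in the token graph\<close>

lemma (in pair_graph) token_arc_sym:
  assumes "(A, B) \<in> parcs (token_graph2 G)"
  shows "(B, A) \<in> parcs (token_graph2 G)"
proof -
  obtain x y where xy: "x \<in> A" "y \<in> B" "(A - B) \<union> (B - A) = {x, y}" "(x, y) \<in> parcs G"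
    using assms by (auto simp: token_graph2_def Let_def)
  have "(y, x) \<in> parcs G"
    using xy(4) pair_sym_arcs by (auto simp: symmetric_def sym_def)
  moreover have "(B - A) \<union> (A - B) = {y, x}"
    using xy(3) by blast
  moreover have "A \<in> pverts (token_graph2 G)" "B \<in> pverts (token_graph2 G)"
    using assms by (auto simp: token_graph2_def Let_def)
  ultimately show ?thesis
    using xy(1,2) by (simp add: token_graph2_def Let_def) blast
qed

text \<open>Each of the two tokens contributes the same amount, whence the factor 2.\<close>

lemma card_token_neighbours_class:
  assumes "distance_regular G d a b c" "A \<in> pverts (token_graph2 G)" "k < d"
  shows "real (card {B. (A, B) \<in> parcs (token_graph2 G) \<and> pair_dist G B = Suc k}) =
    quotient_adjacency d a b c $$ (pair_dist G A - 1, k)"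
proof -
  interpret connected_pair_graph G
    using assms(1) by (auto simp: distance_regular_def connected_pair_graph_def connected_pair_graph_axioms_def)
  have d: "graph_diameter G = d" using assms(1) by (simp add: distance_regular_def)
  obtain u v where uv: "A = {u, v}" "u \<noteq> v" "u \<in> pverts G" "v \<in> pverts G"
    using assms(2) by (rule token_vertexE)
  define i where "i = pair_dist G A - 1"
  have i: "pair_dist G A = Suc i" "i < d"
    using pair_dist_bounds[OF assms(2)] d by (auto simp: i_def)
  have count: "2 * real (card {w. (y, w) \<in> parcs G \<and> graph_dist G x w = Suc k}) =
      quotient_adjacency d a b c $$ (i, k)"
    if xy: "x \<in> pverts G" "y \<in> pverts G" "graph_dist G x y = Suc i" for x y
  proof -
    have reg: "card {w. (y, w) \<in> parcs G \<and> graph_dist G x w + 1 = Suc i} = c (Suc i)"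
      "card {w. (y, w) \<in> parcs G \<and> graph_dist G x w = Suc i} = a (Suc i)"
      "card {w. (y, w) \<in> parcs G \<and> graph_dist G x w = Suc i + 1} = b (Suc i)"
      using assms(1) xy(1,2) unfolding distance_regular_def xy(3)[symmetric] by blast+
    \<comment> \<open>Matrix index \<open>i\<close> stands for distance \<open>Suc i\<close>. An arc
      changes the distance by at most 1, so only the three bands are nonzero, and these are the
      counts in \<open>reg\<close>.\<close>
    consider "k = i" | "k = Suc i" | "i = Suc k" | "k \<noteq> i" "k \<noteq> Suc i" "i \<noteq> Suc k" by blast
    then show ?thesis
    proof cases
      case 4
      have "graph_dist G x w \<noteq> Suc k" if "(y, w) \<in> parcs G" for w
        using 4 xy(3) graph_dist_step_le[OF xy(1) that]
          graph_dist_step_le[OF xy(1) parcs_sym[OF that]] by linarith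
      then have "{w. (y, w) \<in> parcs G \<and> graph_dist G x w = Suc k} = {}" by blast
      then have "card {w. (y, w) \<in> parcs G \<and> graph_dist G x w = Suc k} = 0" by (simp only: card.empty)
      moreover have "quotient_adjacency d a b c $$ (i, k) = 0"
        using 4 i(2) assms(3) by (simp add: quotient_adjacency_def)
      ultimately show ?thesis by (simp only: of_nat_0 mult_zero_right)
    qed (use reg i(2) assms(3) in \<open>auto simp: quotient_adjacency_def\<close>)
  qed
  have "graph_dist G u v = Suc i" "graph_dist G v u = Suc i"
    using i(1) uv graph_dist_sym[of u v] by (simp_all add: pair_dist_doubleton)
  then show ?thesis
    using count[of u v] count[of v u] uv(3,4) card_token_neighbours_at_dist[OF uv(2-4), of "Suc k"]
      i(1) uv(1) by simp
qed

text \<open>The quotient Laplacian arises from the quotient adjacency matrix as row sums minus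
  entries, which reduces its equitability to the adjacency case. The \<open>a\<close>-terms cancel
  on the diagonal, so the identity holds for every \<open>a\<close>.\<close>

lemma quotient_laplacian_eq:
  assumes "i < d" "j < d"
  shows "quotient_laplacian d b c $$ (i, j) =
    (if i = j then \<Sum>l<d. quotient_adjacency d a b c $$ (i, l) else 0) - quotient_adjacency d a b c $$ (i, j)"
proof -
  \<comment> \<open>Each summand is supported at a single \<open>l\<close>. The inner test is needed
    because \<open>i - 1\<close> truncates to the diagonal position when
    \<open>i = 0\<close>.\<close>
  have "quotient_adjacency d a b c $$ (i, l) = (if l = i then 2 * real (a (Suc i)) else 0) +
      (if l = Suc i then 2 * real (b (Suc i)) else 0) +
      (if l = i - 1 then if i = 0 then 0 else 2 * real (c (Suc i)) else 0)" if "l < d" for l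
    using that assms by (auto simp: quotient_adjacency_def)
  then have "(\<Sum>l<d. quotient_adjacency d a b c $$ (i, l)) =
      2 * real (a (Suc i)) + (if Suc i = d then 0 else 2 * real (b (Suc i))) +
      (if i = 0 then 0 else 2 * real (c (Suc i)))"
    using assms by (cases "Suc i = d") (simp_all add: sum.distrib)
  then show ?thesis
    using assms by (cases "i = j") (simp_all add: quotient_adjacency_def quotient_laplacian_def)
qed

lemma sum_over_nth_indicator:
  assumes "distinct vs"
  shows "(\<Sum>j | j < length vs \<and> P (vs ! j). if R (vs ! j) then 1 else 0) =
    (of_nat (card {v \<in> set vs. P v \<and> R v}) :: 'b :: semiring_1)"
proof -
  have "(\<Sum>j | j < length vs \<and> P (vs ! j). if R (vs ! j) then 1 else 0) =
      (of_nat (card ({j. j < length vs \<and> P (vs ! j)} \<inter> {j. R (vs ! j)})) :: 'b)"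
    by (simp add: sum.If_cases)
  also have "bij_betw ((!) vs) ({j. j < length vs \<and> P (vs ! j)} \<inter> {j. R (vs ! j)}) {v \<in> set vs. P v \<and> R v}"
    using bij_betw_nth[OF assms refl refl]
    by (rule bij_betw_subset) (auto simp: in_set_conv_nth)
  then have "card ({j. j < length vs \<and> P (vs ! j)} \<inter> {j. R (vs ! j)}) = card {v \<in> set vs. P v \<and> R v}"
    by (rule bij_betw_same_card)
  finally show ?thesis .
qed

text \<open>Distance classes are shifted to start at \<open>0\<close>, matching the index of the quotient matrices.\<close>

lemma token_matrices_equitable:
  assumes "distance_regular G d a b c" "distinct ps" "set ps = pverts (token_graph2 G)"
    and "i < length ps" "k < d"
  defines "\<kappa> \<equiv> \<lambda>i. pair_dist G (ps ! i) - 1"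
  shows "(\<Sum>j | j < length ps \<and> \<kappa> j = k. adjacency_matrix (token_graph2 G) ps $$ (i, j)) =
      quotient_adjacency d a b c $$ (\<kappa> i, k)" (is ?adj)
    and "(\<Sum>j | j < length ps \<and> \<kappa> j = k. laplacian_matrix (token_graph2 G) ps $$ (i, j)) =
      quotient_laplacian d b c $$ (\<kappa> i, k)" (is ?lap)
proof -
  interpret connected_pair_graph G
    using assms(1) by (auto simp: distance_regular_def connected_pair_graph_def connected_pair_graph_axioms_def)
  let ?T = "token_graph2 G" and ?A = "adjacency_matrix (token_graph2 G) ps" and ?Q = "quotient_adjacency d a b c"
  let ?N = "\<lambda>l. {B. (ps ! i, B) \<in> parcs ?T \<and> pair_dist G B = Suc l}"
  have d: "graph_diameter G = d" using assms(1) by (simp add: distance_regular_def)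
  have pi: "ps ! i \<in> pverts ?T" using assms(3,4) nth_mem by blast
  have arcT: "B \<in> pverts ?T" if "(A, B) \<in> parcs ?T" for A B
    using that by (auto simp: token_graph2_def Let_def)
  have bounds: "1 \<le> pair_dist G B" "pair_dist G B \<le> d" if "B \<in> pverts ?T" for B
    using pair_dist_bounds[OF that] d by simp_all
  have N: "real (card (?N l)) = ?Q $$ (\<kappa> i, l)" if "l < d" for l
    unfolding \<kappa>_def by (rule card_token_neighbours_class[OF assms(1) pi that])
  have "(\<Sum>j | j < length ps \<and> \<kappa> j = k. ?A $$ (i, j)) =
      (\<Sum>j | j < length ps \<and> pair_dist G (ps ! j) - 1 = k. if (ps ! i, ps ! j) \<in> parcs ?T then 1 else 0)"
    using assms(4) by (intro sum.cong) (auto simp: \<kappa>_def adjacency_matrix_def)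
  also have "\<dots> = real (card {B \<in> set ps. pair_dist G B - 1 = k \<and> (ps ! i, B) \<in> parcs ?T})"
    by (rule sum_over_nth_indicator[OF assms(2)])
  \<comment> \<open>Distances of token vertices are at least 1, so the truncated subtraction can be
    undone.\<close>
  also have "{B \<in> set ps. pair_dist G B - 1 = k \<and> (ps ! i, B) \<in> parcs ?T} = ?N k"
    using arcT bounds(1) assms(3) by fastforce
  finally show adj: ?adj using N assms(5) by simp
  have finN: "finite (?N l)" for l
    using arcT finite_set[of ps] unfolding assms(3)
    by (intro finite_subset[of "?N l" "pverts ?T"]) auto
  \<comment> \<open>The neighbours are split by distance class, so the degree is a row sum of the
    quotient adjacency matrix and depends only on the class.\<close>
  have "out_degree (with_proj ?T) (ps ! i) = card (Pair (ps ! i) ` (\<Union>l<d. ?N l))"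
  proof -
    have "out_arcs (with_proj ?T) (ps ! i) = Pair (ps ! i) ` (\<Union>l<d. ?N l)"
    proof (intro equalityI subsetI)
      fix e assume "e \<in> out_arcs (with_proj ?T) (ps ! i)"
      then obtain B where B: "e = (ps ! i, B)" "(ps ! i, B) \<in> parcs ?T"
        by (cases e) (auto simp: out_arcs_def)
      then have "B \<in> ?N (pair_dist G B - 1)" "pair_dist G B - 1 < d"
        using bounds[OF arcT[OF B(2)]] by auto
      then show "e \<in> Pair (ps ! i) ` (\<Union>l<d. ?N l)" using B(1) by blast
    qed (auto simp: out_arcs_def)
    then show ?thesis by (simp add: out_degree_def)
  qed
  also have "\<dots> = card (\<Union>l<d. ?N l)"
    by (intro card_image inj_onI) simp
  also have "\<dots> = (\<Sum>l<d. card (?N l))"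
    using finN by (intro card_UN_disjoint) auto
  finally have deg: "real (out_degree (with_proj ?T) (ps ! i)) = (\<Sum>l<d. ?Q $$ (\<kappa> i, l))"
    using N by simp
  have "\<kappa> i < d" using bounds[OF pi] by (auto simp: \<kappa>_def)
  have "(\<Sum>j | j < length ps \<and> \<kappa> j = k. laplacian_matrix ?T ps $$ (i, j)) =
      (\<Sum>j | j < length ps \<and> \<kappa> j = k. (if i = j then real (out_degree (with_proj ?T) (ps ! i)) else 0) - ?A $$ (i, j))"
    using assms(4) by (intro sum.cong) (auto simp: laplacian_matrix_def degree_matrix_def adjacency_matrix_def)
  also have "\<dots> = (if \<kappa> i = k then real (out_degree (with_proj ?T) (ps ! i)) else 0) - ?Q $$ (\<kappa> i, k)"
    using assms(4) by (simp add: sum_subtractf adj)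
  finally show ?lap
    unfolding quotient_laplacian_eq[OF \<open>\<kappa> i < d\<close> \<open>k < d\<close>, of b c a] deg .
qed

text \<open>The row sums vanish, so the all-ones vector is an eigenvector. The purpose is to have a
  nonempty real spectrum.\<close>

lemma zero_in_spectrum_quotient_laplacian:
  assumes "d \<ge> 1"
  shows "0 \<in> spectrum (quotient_laplacian d b c)"
proof -
  have carrier: "quotient_laplacian d b c \<in> carrier_mat d d" by (simp add: quotient_laplacian_def)
  have "(\<Sum>j<d. quotient_laplacian d b c $$ (i, j) * 1) = 0 * 1" if "i < d" for i
    using that by (simp add: quotient_laplacian_eq[where a = "\<lambda>_. 0"] sum_subtractf)
  then show ?thesis
    unfolding mem_spectrum_iff[OF carrier] using assms
    by (intro exI[of _ "\<lambda>_. 1"] conjI exI[of _ "0 :: nat"]) auto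
qed

theorem proposition5p2:
  fixes G :: "'a pair_pre_digraph"
    and d :: nat
    and a b c :: "nat \<Rightarrow> nat"
    and ps :: "'a set list"
  assumes "distance_regular G d a b c"
    and "d \<ge> 1"
    and "distinct ps" and "set ps = pverts (token_graph2 G)"
  shows "largest_eigenvalue (adjacency_matrix (token_graph2 G) ps)
           = largest_eigenvalue (quotient_adjacency d a b c) \<and>
         largest_eigenvalue (laplacian_matrix (token_graph2 G) ps)
           \<ge> largest_eigenvalue (quotient_laplacian d b c) \<and>
         (bipartite G \<longrightarrow>
           largest_eigenvalue (laplacian_matrix (token_graph2 G) ps)
             = largest_eigenvalue (quotient_laplacian d b c))"
proof (intro conjI impI)
  interpret connected_pair_graph G
    using assms(1) by (auto simp: distance_regular_def connected_pair_graph_def connected_pair_graph_axioms_def)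
  let ?T = "token_graph2 G" and ?n = "length ps"
  let ?A = "adjacency_matrix ?T ps" and ?L = "laplacian_matrix ?T ps"
  define \<kappa> where "\<kappa> = (\<lambda>i. pair_dist G (ps ! i) - 1)"
  have d: "graph_diameter G = d" using assms(1) by (simp add: distance_regular_def)
  have A: "?A \<in> carrier_mat ?n ?n" and L: "?L \<in> carrier_mat ?n ?n"
    and QA: "quotient_adjacency d a b c \<in> carrier_mat d d"
    and QL: "quotient_laplacian d b c \<in> carrier_mat d d"
    by (auto simp: adjacency_matrix_def laplacian_matrix_def degree_matrix_def
        quotient_adjacency_def quotient_laplacian_def intro!: minus_carrier_mat)
  have ps: "ps ! i \<in> pverts ?T" if "i < ?n" for i
    using that assms(4) nth_mem by blast
  have dist: "pair_dist G (ps ! i) = Suc (\<kappa> i)" "\<kappa> i < d" if "i < ?n" for i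
    using pair_dist_bounds[OF ps[OF that]] d by (auto simp: \<kappa>_def)
  have surj: "\<exists>i<?n. \<kappa> i = k" if "k < d" for k
  proof -
    obtain u v where uv: "u \<in> pverts G" "v \<in> pverts G" "graph_dist G u v = Suc k"
      using ex_vertices_at_dist[of "Suc k"] \<open>k < d\<close> d by auto
    then have "u \<noteq> v" by auto
    then have "{u, v} \<in> set ps" using uv assms(4) by (simp add: pverts_token_graph2)
    then obtain i where "i < ?n" "ps ! i = {u, v}" by (auto simp: in_set_conv_nth)
    then show ?thesis using uv by (auto simp: \<kappa>_def pair_dist_doubleton)
  qed
  have "?n > 0" using surj[of 0] assms(2) by auto
  have equitable:
    "(\<Sum>j | j < ?n \<and> \<kappa> j = k. ?A $$ (i, j)) = quotient_adjacency d a b c $$ (\<kappa> i, k)"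
    "(\<Sum>j | j < ?n \<and> \<kappa> j = k. ?L $$ (i, j)) = quotient_laplacian d b c $$ (\<kappa> i, k)"
    if "i < ?n" "k < d" for i k
    unfolding \<kappa>_def using token_matrices_equitable[OF assms(1,3,4) that] by blast+
  have arc_sym: "(ps ! i, ps ! j) \<in> parcs ?T \<longleftrightarrow> (ps ! j, ps ! i) \<in> parcs ?T" for i j
    using token_arc_sym by blast
  \<comment> \<open>Adjacency entries are nonnegative, so the constant sign 1 works.\<close>
  show "largest_eigenvalue ?A = largest_eigenvalue (quotient_adjacency d a b c)"
    by (rule quotient_largest_eigenvalue_eq[OF A QA \<open>?n > 0\<close> dist(2) surj equitable(1), of "\<lambda>_. 1"])
      (use arc_sym in \<open>auto simp: adjacency_matrix_def\<close>)
  show "largest_eigenvalue ?L \<ge> largest_eigenvalue (quotient_laplacian d b c)"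
    using zero_in_spectrum_quotient_laplacian[OF assms(2)]
    by (intro quotient_largest_eigenvalue_le[OF L QL _ dist(2) surj equitable(2)]) auto
  show "largest_eigenvalue ?L = largest_eigenvalue (quotient_laplacian d b c)" if "bipartite G"
  proof (rule quotient_largest_eigenvalue_eq[OF L QL \<open>?n > 0\<close> dist(2) surj equitable(2), of "\<lambda>k. (-1) ^ k"])
    fix i j assume ij: "i < ?n" "j < ?n"
    show "?L $$ (i, j) = ?L $$ (j, i)"
      using ij arc_sym by (simp add: laplacian_matrix_def degree_matrix_def adjacency_matrix_def)
    assume "i \<noteq> j"
    \<comment> \<open>The shift by 1 in \<kappa> flips both parities and keeps them opposite. An
      off-diagonal Laplacian entry is -1 on arcs, where the signs differ, and 0 elsewhere.\<close>
    have "even (\<kappa> i) \<longleftrightarrow> odd (\<kappa> j)" if "(ps ! i, ps ! j) \<in> parcs ?T"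
      using token_arc_parity[OF \<open>bipartite G\<close> that] dist(1) ij by auto
    then show "(-1) ^ \<kappa> i * (-1) ^ \<kappa> j * ?L $$ (i, j) \<ge> 0"
      using ij \<open>i \<noteq> j\<close>
      by (auto simp: laplacian_matrix_def degree_matrix_def adjacency_matrix_def minus_one_power_iff)
  qed (simp_all add: power_abs)
qed

end
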